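(* For every $t\in\mathbb R$ and every real $\rho>0$, $$\mathsf P_{t,\rho}(N)\leqslant N^{5/6+o(1)}+N^{1-1/\rho+o(1)},\qquad N\to\infty.$$
   Context: Let $\mathbf e(z)=\exp(2\pi i z)$, $\mathsf T_2=[0,1]^2$, and for real $x,y$ and a positive integer $N$ let $G(x,y;N)=\sum_{n=1}^N\mathbf e(xn+yn^2)$. For $t\in\mathbb R$ let $\pi_t:\mathbb R^2\to\mathbb R$, $\pi_t(x,y)=x+ty$, and define $$\mathsf P_{t,\rho}(N)=\Big(\int_{\mathbb R}\sup_{(x,y)\in\pi_t^{-1}(z)\cap\mathsf T_2}|G(x,y;N)|^\rho\,dz\Big)^{1/\rho},$$ where the supremum over the empty set is $0$. The notation $F(N)\leqslant N^{a+o(1)}+N^{b+o(1)}$ means: for every $\varepsilon>0$, $F(N)\leqslant N^{a+\varepsilon}+N^{b+\varepsilon}$ for all sufficiently large $N$ (depending on $\varepsilon$, $t$ and $\rho$). *)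

theory Defs
  imports "HOL-Analysis.Analysis"
begin

definition e_fn :: "real \<Rightarrow> complex" where
  "e_fn z = exp (2 * of_real pi * \<i> * of_real z)"

definition unit_square :: "(real \<times> real) set" where
  "unit_square = {0..1} \<times> {0..1}"

definition gauss_sum :: "real \<Rightarrow> real \<Rightarrow> nat \<Rightarrow> complex" where
  "gauss_sum x y N = (\<Sum>n = 1..N. e_fn (x * real n + y * (real n)\<^sup>2))"

definition proj :: "real \<Rightarrow> real \<times> real \<Rightarrow> real" where
  "proj t = (\<lambda>(x, y). x + t * y)"

text \<open>The value 0 on empty fibres has to be imposed, as \<open>Sup {}\<close> is unspecified for reals.\<close>

definition fibre_sup :: "real \<Rightarrow> real \<Rightarrow> nat \<Rightarrow> real \<Rightarrow> real" where
  "fibre_sup t \<rho> N z =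
     (if proj t -` {z} \<inter> unit_square = {} then 0
      else (SUP (x, y) \<in> proj t -` {z} \<inter> unit_square. norm (gauss_sum x y N) powr \<rho>))"

definition proj_norm :: "real \<Rightarrow> real \<Rightarrow> nat \<Rightarrow> real" where
  "proj_norm t \<rho> N = (LINT z|lborel. fibre_sup t \<rho> N z) powr (1 / \<rho>)"

text \<open>The supremum and the integral never take a default value: the fibre values are bounded above
  and \<^term>\<open>fibre_sup t \<rho> N\<close> is integrable whenever \<open>\<rho> > 0\<close>.\<close>

lemma norm_gauss_sum_le: "norm (gauss_sum x y N) \<le> real N"
proof -
  have "norm (e_fn z) = 1" for z
    by (simp add: e_fn_def)
  then have "norm (gauss_sum x y N) \<le> (\<Sum>n = 1..N. 1)"
    unfolding gauss_sum_def by (intro sum_norm_le) simp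
  then show ?thesis by simp
qed

lemma bdd_above_fibre:
  assumes "\<rho> > 0"
  shows "bdd_above ((\<lambda>(x, y). norm (gauss_sum x y N) powr \<rho>) ` A)"
  using assms norm_gauss_sum_le[of _ _ N]
  by (intro bdd_aboveI[where M = "real N powr \<rho>"]) (auto intro!: powr_mono2)

lemma integrable_fibre_sup:
  assumes "\<rho> > 0"
  shows "integrable lborel (fibre_sup t \<rho> N)"
proof -
  define h where "h = (\<lambda>(x, y). norm (gauss_sum x y N) powr \<rho>)"
  define F where "F = (\<lambda>z. proj t -` {z} \<inter> unit_square)"
  have f: "fibre_sup t \<rho> N z = (if F z = {} then 0 else Sup (h ` F z))" for z
    by (simp add: fibre_sup_def h_def F_def)
  have bdd: "bdd_above (h ` A)" for A
    unfolding h_def by (rule bdd_above_fibre[OF assms])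
  have h0: "h p \<ge> 0" and hN: "h p \<le> real N powr \<rho>" for p
    using assms norm_gauss_sum_le[of "fst p" "snd p" N]
    by (auto simp: h_def case_prod_beta intro!: powr_mono2)
  have conth: "continuous_on A h" for A
    unfolding h_def case_prod_beta gauss_sum_def e_fn_def
    by (rule continuous_on_powr'; use assms in \<open>auto intro!: continuous_intros\<close>)
  have contp: "continuous_on A (proj t)" for A
    unfolding proj_def case_prod_beta by (intro continuous_intros)
  have csq: "compact unit_square"
    unfolding unit_square_def by (intro compact_Times compact_Icc)
  have cF: "compact (F z)" for z
  proof -
    have "closed (proj t -` {z})"
      using contp[of UNIV] by (intro closed_vimage) auto
    then show ?thesis
      unfolding F_def using closed_Int_compact csq by blast
  qed
  have att: "\<exists>p\<in>F z. Sup (h ` F z) = h p" if ne: "F z \<noteq> {}" for z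
  proof -
    obtain p where p: "p \<in> F z" "\<forall>q\<in>F z. h q \<le> h p"
      using continuous_attains_sup[OF cF ne conth] by blast
    then have "Sup (h ` F z) = h p"
      by (intro cSup_eq_maximum) auto
    then show ?thesis using p by blast
  qed
  have f0: "fibre_sup t \<rho> N z \<ge> 0" and fN: "fibre_sup t \<rho> N z \<le> real N powr \<rho>" for z
    using att[of z] h0 hN by (fastforce simp: f)+
  have meas: "fibre_sup t \<rho> N \<in> borel_measurable borel"
    unfolding borel_measurable_iff_ge
  proof
    fix a :: real
    show "{w \<in> space borel. a \<le> fibre_sup t \<rho> N w} \<in> sets borel"
    proof (cases "a \<le> 0")
      case True
      then have "{w \<in> space borel. a \<le> fibre_sup t \<rho> N w} = UNIV"
        by (auto intro: order_trans[OF _ f0])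
      then show ?thesis by simp
    next
      case False
      have "{w \<in> space borel. a \<le> fibre_sup t \<rho> N w} = proj t ` (unit_square \<inter> h -` {a..})"
      proof (intro equalityI subsetI)
        fix z assume "z \<in> {w \<in> space borel. a \<le> fibre_sup t \<rho> N w}"
        then have "F z \<noteq> {}" "a \<le> Sup (h ` F z)"
          using False by (auto simp: f split: if_splits)
        then obtain p where "p \<in> F z" "a \<le> h p"
          using att[of z] by auto
        then show "z \<in> proj t ` (unit_square \<inter> h -` {a..})"
          by (auto simp: F_def)
      next
        fix z assume "z \<in> proj t ` (unit_square \<inter> h -` {a..})"
        then obtain p where p: "p \<in> F z" "a \<le> h p"
          by (auto simp: F_def)
        then have "h p \<le> Sup (h ` F z)"
          by (intro cSup_upper bdd) auto
        then show "z \<in> {w \<in> space borel. a \<le> fibre_sup t \<rho> N w}"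
          using p by (auto simp: f)
      qed
      moreover have "closed (h -` {a..})"
        using conth[of UNIV] by (intro closed_vimage) auto
      then have "compact (proj t ` (unit_square \<inter> h -` {a..}))"
        using csq by (intro compact_continuous_image contp compact_Int_closed)
      ultimately show ?thesis by (simp add: borel_compact)
    qed
  qed
  define B where "B = proj t ` unit_square"
  have cB: "compact B"
    unfolding B_def by (intro compact_continuous_image contp csq)
  have "integrable lborel (\<lambda>z. indicat_real B z * (real N powr \<rho>))"
    using borel_compact[OF cB] emeasure_compact_finite[OF cB]
    by (intro integrable_mult_left) auto
  then show ?thesis
  proof (rule Bochner_Integration.integrable_bound)
    show "fibre_sup t \<rho> N \<in> borel_measurable lborel"
      using meas by simp
    show "AE z in lborel. norm (fibre_sup t \<rho> N z) \<le> norm (indicat_real B z * real N powr \<rho>)"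
    proof (intro AE_I2)
      fix z
      have "F z = {}" if "z \<notin> B"
        using that by (auto simp: F_def B_def)
      then show "norm (fibre_sup t \<rho> N z) \<le> norm (indicat_real B z * real N powr \<rho>)"
        using f0[of z] fN[of z] by (cases "z \<in> B") (auto simp: f)
    qed
  qed
qed

end

theory Submission
  imports Defs "HOL-Real_Asymp.Real_Asymp"
begin

text \<open>If \<open>|G(x,y;N)| \<ge> A\<close> with \<open>A\<^sup>2\<close> at least a large multiple of \<open>N log N\<close>, then \<open>x\<close> and \<open>y\<close> are close to
  rationals \<open>b/(2q)\<close> and \<open>a/(2q)\<close> with \<open>q \<lesssim> (N/A)\<^sup>2\<close>. To see this, approximate \<open>2y\<close> by \<open>a/q\<close> and
  expand \<open>|G|\<^sup>2\<close> over pairs \<open>(m,n)\<close>. The pairs with \<open>q\<close> not dividing \<open>m - n\<close> contribute \<open>O(N log N)\<close>;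
  the others are bounded in three ways. Counting them bounds \<open>q\<close>; geometric sums bound \<open>|2y - a/q|\<close>;
  and since they add up to the squares of the sums over residue classes modulo \<open>q\<close>, whose phases are
  nearly linear with slope \<open>q x + a q/2\<close>, they bound the distance of this slope to the integers. No
  evaluation of complete Gauss sums is needed.

  Consequently the \<open>z\<close> whose fibre contains such a point are covered by intervals of total length
  \<open>O(N\<^sup>5 log N / A\<^sup>6)\<close>, and integrating over finitely many levels \<open>A\<close> between \<open>N\<^bsup>5/6\<^esup>\<close> and \<open>N\<close> gives
  the two terms, according to whether \<open>\<rho> \<le> 6\<close> or \<open>\<rho> \<ge> 6\<close>.\<close>

section \<open>Exponential sums\<close>

lemma norm_e_fn [simp]: "norm (e_fn s) = 1"
  by (simp add: e_fn_def)

lemma e_fn_add: "e_fn (s + u) = e_fn s * e_fn u"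
  by (simp add: e_fn_def distrib_left exp_add)

lemma cnj_e_fn: "cnj (e_fn s) = e_fn (- s)"
  by (simp add: e_fn_def exp_cnj)

lemma e_fn_of_int [simp]: "e_fn (of_int k) = 1"
  using exp_integer_2pi[of "of_int k"] by (simp add: e_fn_def algebra_simps)

lemma norm_one_minus_e_fn: "norm (1 - e_fn s) = 2 * \<bar>sin (pi * s)\<bar>"
  using dist_exp_i_1[of "2 * pi * s"]
  by (simp add: e_fn_def norm_minus_commute algebra_simps)

lemma norm_one_minus_e_fn_add_int: "norm (1 - e_fn (s + of_int k)) = norm (1 - e_fn s)"
  by (simp add: e_fn_add)

lemma norm_one_minus_e_fn_le: "norm (1 - e_fn s) \<le> 2 * pi * \<bar>s\<bar>"
  using abs_sin_x_le_abs_x[of "pi * s"] by (simp add: norm_one_minus_e_fn abs_mult)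

lemma norm_e_fn_diff_le: "norm (e_fn s - e_fn u) \<le> 2 * pi * \<bar>s - u\<bar>"
proof -
  have "e_fn s - e_fn u = - (e_fn u * (1 - e_fn (s - u)))"
    using e_fn_add[of u "s - u"] by (simp add: algebra_simps)
  then have "norm (e_fn s - e_fn u) = norm (1 - e_fn (s - u))"
    by (simp add: norm_mult)
  then show ?thesis
    using norm_one_minus_e_fn_le by simp
qed

text \<open>Jordan's inequality: by concavity the sine lies above its chord on [0, pi/2].\<close>

lemma norm_one_minus_e_fn_ge:
  assumes "\<bar>s\<bar> \<le> 1 / 2"
  shows "norm (1 - e_fn s) \<ge> 4 * \<bar>s\<bar>"
proof -
  have *: "sin (pi * u) \<ge> 2 * u" if u: "0 \<le> u" "u \<le> 1 / 2" for u :: real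
  proof -
    have "concave_on {0..pi/2} sin"
      by (rule f''_le0_imp_concave[where f' = cos and f'' = "\<lambda>x. - sin x"])
         (auto intro!: derivative_eq_intros sin_ge_zero)
    then have "convex_on {0..pi/2} (\<lambda>x. - sin x)"
      by (simp add: concave_on_def)
    then have "- sin ((1 - 2 * u) *\<^sub>R 0 + (2 * u) *\<^sub>R (pi / 2)) \<le> (1 - 2 * u) * (- sin 0) + (2 * u) * (- sin (pi / 2))"
      using u by (intro convex_onD) auto
    then show ?thesis
      by (simp add: mult.commute)
  qed
  have "\<bar>sin (pi * s)\<bar> \<ge> 2 * \<bar>s\<bar>"
    using *[of s] *[of "- s"] assms by (cases "s \<ge> 0") auto
  then show ?thesis
    by (simp add: norm_one_minus_e_fn)
qed

lemma norm_one_minus_e_fn_ge_min: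
  assumes "0 \<le> s" "s \<le> 1"
  shows "norm (1 - e_fn s) \<ge> 4 * min s (1 - s)"
proof (cases "s \<le> 1 / 2")
  case True
  then show ?thesis using norm_one_minus_e_fn_ge[of s] assms by simp
next
  case False
  have "norm (1 - e_fn s) = norm (1 - e_fn (s - 1))"
    using norm_one_minus_e_fn_add_int[of "s - 1" 1] by simp
  then show ?thesis using norm_one_minus_e_fn_ge[of "s - 1"] assms False by simp
qed

text \<open>Multiplication by \<open>1 - e_fn s\<close> telescopes the sum to two end terms of
  modulus 1.\<close>

lemma norm_geometric_e_fn_le:
  fixes l u :: int
  assumes "e_fn s \<noteq> 1"
  shows "norm (\<Sum>n\<in>{l..u}. e_fn (s * of_int n)) \<le> 2 / norm (1 - e_fn s)"
\<comment> \<open>The empty range \<open>l = u + 1\<close> is included so that it can start the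
  induction.\<close>
proof (cases "l \<le> u + 1")
  case True
  have "(1 - e_fn s) * (\<Sum>n\<in>{l..u}. e_fn (s * of_int n)) = e_fn (s * of_int l) - e_fn (s * of_int (u + 1))"
    using True
  proof (induction "nat (u + 1 - l)" arbitrary: u)
    case 0
    then have "l = u + 1" by simp
    then show ?case by simp
  next
    case (Suc k)
    then have *: "{l..u} = insert u {l..u - 1}" by auto
    have "k = nat (u - 1 + 1 - l)" "l \<le> u - 1 + 1"
      using Suc.hyps(2) by auto
    note IH = Suc.hyps(1)[OF this]
    have "(1 - e_fn s) * (\<Sum>n\<in>{l..u}. e_fn (s * of_int n))
        = (1 - e_fn s) * e_fn (s * of_int u) + (1 - e_fn s) * (\<Sum>n\<in>{l..u - 1}. e_fn (s * of_int n))"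
      unfolding * by (simp add: distrib_left)
    also have "(1 - e_fn s) * e_fn (s * of_int u) = e_fn (s * of_int u) - e_fn (s * of_int (u + 1))"
      using e_fn_add[of "s * of_int u" s] by (simp add: algebra_simps)
    finally show ?case
      using IH by simp
  qed
  then have "norm (1 - e_fn s) * norm (\<Sum>n\<in>{l..u}. e_fn (s * of_int n)) \<le> 2"
    by (metis norm_mult norm_triangle_ineq4 norm_e_fn one_add_one)
  then show ?thesis
    using assms by (simp add: field_simps)
qed simp

text \<open>The difference \<open>harm n - ln n\<close> decreases from its value 1 at n = 1.\<close>

lemma harm_le:
  assumes "n > 0"
  shows "harm n \<le> 1 + ln (real n)"
proof -
  obtain m where m: "n = Suc m" using assms by (cases n) auto
  have "harm (Suc m) - ln (real (Suc m)) \<le> harm (Suc 0) - ln (real (Suc 0))"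
    using decseqD[OF decseq_harm_diff_ln, of 0 m] by simp
  then show ?thesis by (simp add: m harm_def)
qed

text \<open>The quotients \<open>1 / (1 - v m)\<close> turn \<open>u m\<close> into a telescoping difference, so the sum is
  governed by their size and total variation.\<close>

lemma norm_sum_unimodular_le:
  fixes u v :: "nat \<Rightarrow> complex"
  assumes u: "\<And>m. norm (u m) = 1" and step: "\<And>m. m \<le> M \<Longrightarrow> u (Suc m) = u m * v m"
    and d: "d > 0" "\<And>m. m \<le> M \<Longrightarrow> norm (1 - v m) \<ge> d"
    and k: "\<And>m. m < M \<Longrightarrow> norm (v (Suc m) - v m) \<le> \<kappa>"
  shows "norm (\<Sum>m\<le>M. u m) \<le> (2 + M * \<kappa> / d) / d"
proof -
  define c where "c m = 1 / (1 - v m)" for m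
  have nz: "1 - v m \<noteq> 0" if "m \<le> M" for m
    using d(2)[OF that] d(1) by auto
  have c: "norm (c m) \<le> 1 / d" if "m \<le> M" for m
    using d(2)[OF that] d(1) by (simp add: c_def norm_divide frac_le)
  have diff: "norm (c (Suc m) - c m) \<le> \<kappa> / d / d" if "m < M" for m
  proof -
    have "c (Suc m) - c m = (v (Suc m) - v m) * c (Suc m) * c m"
      using nz[of m] nz[of "Suc m"] that by (simp add: c_def field_simps)
    then have "norm (c (Suc m) - c m) = norm (v (Suc m) - v m) * norm (c (Suc m)) * norm (c m)"
      by (simp add: norm_mult)
    also have "\<dots> \<le> \<kappa> * (1 / d) * (1 / d)"
      using k[OF that] c[of m] c[of "Suc m"] that d(1) order_trans[OF norm_ge_zero k[OF that]]
      by (intro mult_mono mult_nonneg_nonneg) auto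
    finally show ?thesis by simp
  qed
  have tel: "u m = c m * u m - c m * u (Suc m)" if "m \<le> M" for m
  proof -
    have "u m = (c m * (1 - v m)) * u m"
      using nz[OF that] by (simp add: c_def)
    also have "\<dots> = c m * u m - c m * u (Suc m)"
      by (simp add: step[OF that] algebra_simps)
    finally show ?thesis .
  qed
  \<comment> \<open>Summation by parts: the differences of the coefficients are collected at
    \<open>u (Suc m)\<close>.\<close>
  have *: "K \<le> M \<Longrightarrow> (\<Sum>m\<le>K. u m) = c 0 * u 0 - c K * u (Suc K) + (\<Sum>m<K. (c (Suc m) - c m) * u (Suc m))" for K
  proof (induction K)
    case 0
    then show ?case using tel[of 0] by simp
  next
    case (Suc K)
    define X where "X = (\<Sum>m<K. (c (Suc m) - c m) * u (Suc m))"
    have "(\<Sum>m\<le>Suc K. u m) = c 0 * u 0 - c K * u (Suc K) + X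
        + (c (Suc K) * u (Suc K) - c (Suc K) * u (Suc (Suc K)))"
      using Suc tel[of "Suc K"] by (simp add: X_def)
    moreover have "(\<Sum>m<Suc K. (c (Suc m) - c m) * u (Suc m)) = X + (c (Suc K) - c K) * u (Suc K)"
      by (simp add: X_def)
    ultimately show ?case by (simp add: algebra_simps)
  qed
  have "norm (\<Sum>m<M. (c (Suc m) - c m) * u (Suc m)) \<le> (\<Sum>m<M. \<kappa> / d / d)"
    using diff u by (intro sum_norm_le) (auto simp: norm_mult)
  moreover have "norm (c 0 * u 0 - c M * u (Suc M)) \<le> 1 / d + 1 / d"
    using c[of 0] c[of M] u norm_triangle_ineq4[of "c 0 * u 0" "c M * u (Suc M)"] by (simp add: norm_mult)
  moreover have "norm (\<Sum>m\<le>M. u m) \<le> norm (c 0 * u 0 - c M * u (Suc M)) + norm (\<Sum>m<M. (c (Suc m) - c m) * u (Suc m))"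
    using *[of M] norm_triangle_ineq by simp
  moreover have "(2 + M * \<kappa> / d) / d = 1 / d + 1 / d + (\<Sum>m<M. \<kappa> / d / d)"
    using d(1) by (simp add: add_divide_distrib)
  ultimately show ?thesis by linarith
qed

section \<open>Differencing\<close>

text \<open>Pairs are grouped by their difference h; for fixed h the second index runs through an
  interval. The predicate \<open>P\<close> lets this serve both the multiples and the non-multiples
  of q.\<close>

lemma norm_sum_correlations_le:
  fixes F :: "int \<Rightarrow> complex" and N :: int
  assumes "\<And>h. P h \<Longrightarrow> \<bar>h\<bar> \<le> N \<Longrightarrow> norm (\<Sum>n\<in>{max 1 (1 - h)..min N (N - h)}. F (n + h) * cnj (F n)) \<le> B h"
  shows "norm (\<Sum>p\<in>{p \<in> {1..N} \<times> {1..N}. P (fst p - snd p)}. F (fst p) * cnj (F (snd p)))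
           \<le> (\<Sum>h\<in>{h \<in> {-N..N}. P h}. B h)"
proof -
  define S where "S = {p \<in> {1..N} \<times> {1..N}. P (fst p - snd p)}"
  define T where "T = {h \<in> {-N..N}. P h}"
  have "finite S" "finite T"
    unfolding S_def T_def by (intro finite_Collect_conjI disjI1; simp)+
  moreover have "(\<lambda>p. fst p - snd p) ` S \<subseteq> T"
    by (auto simp: S_def T_def)
  ultimately have "(\<Sum>p\<in>S. F (fst p) * cnj (F (snd p)))
      = (\<Sum>h\<in>T. \<Sum>p\<in>{p. p \<in> S \<and> fst p - snd p = h}. F (fst p) * cnj (F (snd p)))"
    by (simp add: sum.group)
  also have "\<dots> = (\<Sum>h\<in>T. \<Sum>n\<in>{max 1 (1 - h)..min N (N - h)}. F (n + h) * cnj (F n))"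
  proof (rule sum.cong[OF refl])
    fix h assume "h \<in> T"
    then have "P h" by (simp add: T_def)
    show "(\<Sum>p\<in>{p. p \<in> S \<and> fst p - snd p = h}. F (fst p) * cnj (F (snd p)))
        = (\<Sum>n\<in>{max 1 (1 - h)..min N (N - h)}. F (n + h) * cnj (F n))"
      by (rule sum.reindex_bij_witness[where j = snd and i = "\<lambda>n. (n + h, n)"])
         (use \<open>P h\<close> in \<open>auto simp: S_def\<close>)
  qed
  also have "norm \<dots> \<le> (\<Sum>h\<in>T. B h)"
    by (intro sum_norm_le assms) (auto simp: T_def)
  finally show ?thesis by (simp add: S_def T_def)
qed

section \<open>Correlations of the quadratic phase; pairs not congruent modulo q\<close>

definition qphase :: "real \<Rightarrow> real \<Rightarrow> int \<Rightarrow> complex" where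
  "qphase x y n = e_fn (x * of_int n + y * (of_int n)\<^sup>2)"

lemma norm_qphase [simp]: "norm (qphase x y n) = 1"
  by (simp add: qphase_def)

text \<open>Integer indices allow negative shifts h in the correlations.\<close>

lemma gauss_sum_eq: "gauss_sum x y N = (\<Sum>n\<in>{1..int N}. qphase x y n)"
  unfolding gauss_sum_def
  by (rule sum.reindex_bij_witness[where i = nat and j = int]) (auto simp: qphase_def)

lemma norm_qphase_correlation_le_card:
  "norm (\<Sum>n\<in>{max 1 (1 - h)..min (int N) (int N - h)}. qphase x y (n + h) * cnj (qphase x y n)) \<le> real N"
proof -
  have "norm (\<Sum>n\<in>{max 1 (1 - h)..min (int N) (int N - h)}. qphase x y (n + h) * cnj (qphase x y n))
      \<le> (\<Sum>n\<in>{max 1 (1 - h)..min (int N) (int N - h)}. 1)"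
    by (intro sum_norm_le) (simp add: norm_mult)
  also have "\<dots> \<le> real N"
    by simp
  finally show ?thesis .
qed

text \<open>Weyl differencing: the terms quadratic in n cancel, leaving a constant phase times a
  geometric sum with ratio \<open>e_fn (2 * y * of_int h)\<close>.\<close>

lemma norm_qphase_correlation_le:
  fixes l u :: int
  assumes "e_fn (2 * y * of_int h) \<noteq> 1"
  shows "norm (\<Sum>n\<in>{l..u}. qphase x y (n + h) * cnj (qphase x y n))
           \<le> 2 / norm (1 - e_fn (2 * y * of_int h))"
proof -
  have "qphase x y (n + h) * cnj (qphase x y n)
      = e_fn (x * of_int h + y * (of_int h)\<^sup>2) * e_fn (2 * y * of_int h * of_int n)" for n
    unfolding qphase_def cnj_e_fn e_fn_add[symmetric]
    by (simp add: algebra_simps power2_eq_square)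
  then have "(\<Sum>n\<in>{l..u}. qphase x y (n + h) * cnj (qphase x y n))
      = e_fn (x * of_int h + y * (of_int h)\<^sup>2) * (\<Sum>n\<in>{l..u}. e_fn (2 * y * of_int h * of_int n))"
    by (simp add: sum_distrib_left)
  then show ?thesis
    using norm_geometric_e_fn_le[OF assms] by (simp add: norm_mult)
qed

text \<open>Modulo 1, the frequency is (j + \<tau>) / q with |\<tau>| \<le> 1/2, and coprimality
  makes j non-zero, so its distance to the integers is at least min(j, q - j) / (2 q). Bounding a
  maximum by a sum of two reciprocals prepares for harmonic sums over j.\<close>

lemma inverse_norm_one_minus_e_fn_le:
  fixes a q h :: int
  assumes q: "q > 0" and cop: "coprime a q" and h: "\<not> q dvd h"
    and close: "\<bar>of_int h * (of_int q * \<alpha> - of_int a)\<bar> \<le> 1 / 2"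
  defines "j \<equiv> (h * a) mod q"
  shows "j \<in> {1..q - 1}" "e_fn (\<alpha> * of_int h) \<noteq> 1"
    "2 / norm (1 - e_fn (\<alpha> * of_int h)) \<le> of_int q / of_int j + of_int q / of_int (q - j)"
proof -
  have "\<not> q dvd h * a"
    using h cop by (simp add: coprime_commute coprime_dvd_mult_left_iff)
  then show j: "j \<in> {1..q - 1}"
    using q pos_mod_bound[of q "h * a"] pos_mod_sign[of q "h * a"]
    by (auto simp: j_def dvd_eq_mod_eq_0 simp del: pos_mod_bound pos_mod_sign)
  define \<tau> where "\<tau> = of_int h * (of_int q * \<alpha> - of_int a)"
  define s where "s = (of_int j + \<tau>) / of_int q"
  define k where "k = (h * a) div q"
  have "h * a = q * k + j" by (simp add: k_def j_def)
  then have ha: "real_of_int h * of_int a = of_int q * of_int k + of_int j"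
    by (metis of_int_add of_int_mult)
  have \<alpha>: "\<alpha> * of_int h = s + of_int k"
    using q ha by (simp add: s_def \<tau>_def field_simps)
  define \<mu> where "\<mu> = real_of_int (min j (q - j))"
  have \<mu>1: "\<mu> \<ge> 1" using j by (simp add: \<mu>_def)
  have \<tau>: "\<bar>\<tau>\<bar> \<le> 1 / 2" using close by (simp add: \<tau>_def)
  have jq: "real_of_int j \<ge> \<mu>" "real_of_int (q - j) \<ge> \<mu>"
    by (auto simp: \<mu>_def)
  \<comment> \<open>As \<mu> \<ge> 1, a perturbation of size 1/2 costs at most half of
    \<mu>.\<close>
  have s1: "s \<ge> \<mu> / (2 * of_int q)"
    using q \<tau> jq \<mu>1 unfolding s_def by (simp add: field_simps)
  have s2: "1 - s \<ge> \<mu> / (2 * of_int q)"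
    using q \<tau> jq \<mu>1 unfolding s_def by (simp add: field_simps)
  have pos: "\<mu> / (2 * of_int q) > 0" using q \<mu>1 by simp
  have "norm (1 - e_fn s) \<ge> 4 * min s (1 - s)"
    using s1 s2 pos by (intro norm_one_minus_e_fn_ge_min) linarith+
  then have n: "norm (1 - e_fn (\<alpha> * of_int h)) \<ge> 2 * (\<mu> / of_int q)"
    using s1 s2 by (simp add: \<alpha> norm_one_minus_e_fn_add_int min_def split: if_splits)
  then show "e_fn (\<alpha> * of_int h) \<noteq> 1"
    using pos by auto
  have "2 / norm (1 - e_fn (\<alpha> * of_int h)) \<le> 2 / (2 * (\<mu> / of_int q))"
    using n pos by (intro frac_le) auto
  also have "\<dots> = of_int q / \<mu>" by simp
  also have "\<dots> \<le> of_int q / of_int j + of_int q / of_int (q - j)"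
    using j by (auto simp: \<mu>_def min_def)
  finally show "2 / norm (1 - e_fn (\<alpha> * of_int h)) \<le> of_int q / of_int j + of_int q / of_int (q - j)" .
qed

lemma sum_inverse_int_le:
  fixes M :: int
  assumes "M > 0"
  shows "(\<Sum>j\<in>{1..M}. 1 / real_of_int j) \<le> 1 + ln (real_of_int M)"
proof -
  have "(\<Sum>j\<in>{1..M}. 1 / real_of_int j) = harm (nat M)"
    unfolding harm_def
    by (rule sum.reindex_bij_witness[where i = int and j = nat]) (auto simp: field_simps)
  then show ?thesis
    using harm_le[of "nat M"] assms by simp
qed

text \<open>Within a block of fixed quotient \<open>h div q\<close> the residues
  \<open>(h * a) mod q\<close> are distinct and non-zero, so the block contributes O(q log q); there
  are O(N / q + 1) blocks.\<close>

lemma sum_off_diagonal_le: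
  fixes a q :: int and N :: nat
  assumes q: "0 < q" "q \<le> 2 * int N" and cop: "coprime a q"
    and close: "\<bar>of_int q * \<alpha> - of_int a\<bar> \<le> 1 / (2 * real N)"
  shows "(\<Sum>h\<in>{h \<in> {- int N..int N}. \<not> q dvd h}. 2 / norm (1 - e_fn (\<alpha> * of_int h)))
          \<le> 24 * real N * (1 + ln (real N))"
proof -
  define S where "S = {h \<in> {- int N..int N}. \<not> q dvd h}"
  define w where "w j = real_of_int q / of_int j + of_int q / of_int (q - j)" for j
  \<comment> \<open>One extra block on the negative side, since \<open>div\<close> rounds
    down.\<close>
  define R where "R = {- (int N div q) - 1..int N div q}"
  define g where "g h = (h div q, (h * a) mod q)" for h
  have N: "N > 0" using q by linarith
  have close': "\<bar>of_int h * (of_int q * \<alpha> - of_int a)\<bar> \<le> 1 / 2" if "h \<in> S" for h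
  proof -
    have "real_of_int \<bar>h\<bar> \<le> real N" using that unfolding S_def by simp linarith
    then have "\<bar>of_int h\<bar> * \<bar>of_int q * \<alpha> - of_int a\<bar> \<le> real N * (1 / (2 * real N))"
      using close by (intro mult_mono) auto
    then show ?thesis using N by (simp add: abs_mult)
  qed
  have nd: "\<not> q dvd h" if "h \<in> S" for h using that by (simp add: S_def)
  note * = inverse_norm_one_minus_e_fn_le[OF q(1) cop nd close']
  have inj: "inj_on g S"
  proof (rule inj_onI)
    fix h h' assume "g h = g h'"
    then have 1: "h div q = h' div q" and 2: "(h * a) mod q = (h' * a) mod q"
      by (auto simp: g_def)
    from 2 have "q dvd (h - h') * a"
      by (simp add: mod_eq_dvd_iff left_diff_distrib)
    then have "q dvd h - h'"
      using cop by (simp add: coprime_commute coprime_dvd_mult_left_iff)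
    then have "h mod q = h' mod q" by (simp add: mod_eq_dvd_iff)
    then show "h = h'" using 1 by (metis div_mult_mod_eq)
  qed
  have img: "g ` S \<subseteq> R \<times> {1..q - 1}"
  proof clarify
    fix h k j assume h: "h \<in> S" and g: "(k, j) = g h"
    have "h div q \<le> int N div q"
      using h q by (intro zdiv_mono1) (auto simp: S_def)
    moreover have "(- int N) div q \<le> h div q"
      using h q by (intro zdiv_mono1) (auto simp: S_def)
    moreover have "(- int N) div q \<ge> - (int N div q) - 1"
      using q by (simp add: zdiv_zminus1_eq_if)
    ultimately show "k \<in> R \<and> j \<in> {1..q - 1}"
      using *(1)[OF h h] g by (auto simp: g_def R_def)
  qed
  have w0: "w j \<ge> 0" if "j \<in> {1..q - 1}" for j
    using that by (auto simp: w_def intro!: add_nonneg_nonneg divide_nonneg_nonneg)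
  have "(\<Sum>h\<in>S. 2 / norm (1 - e_fn (\<alpha> * of_int h))) \<le> (\<Sum>h\<in>S. w ((h * a) mod q))"
    using *(3) by (intro sum_mono) (simp add: w_def)
  also have "\<dots> = (\<Sum>p\<in>g ` S. w (snd p))"
    by (simp add: sum.reindex[OF inj]) (simp add: g_def)
  also have "\<dots> \<le> (\<Sum>p\<in>R \<times> {1..q - 1}. w (snd p))"
    using img w0 by (intro sum_mono2) (auto simp: R_def)
  also have "\<dots> = real (card R) * (\<Sum>j\<in>{1..q - 1}. w j)"
    by (simp add: sum.cartesian_product' )
  finally have 1: "(\<Sum>h\<in>S. 2 / norm (1 - e_fn (\<alpha> * of_int h))) \<le> real (card R) * (\<Sum>j\<in>{1..q - 1}. w j)" .
  have 2: "(\<Sum>j\<in>{1..q - 1}. w j) \<le> 2 * of_int q * (1 + ln (of_int q))"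
  \<comment> \<open>For q = 1 the sum is empty; otherwise j and q - j contribute equal
    halves.\<close>
  proof (cases "q = 1")
    case False
    have "(\<Sum>j\<in>{1..q - 1}. of_int q / of_int (q - j)) = (\<Sum>j\<in>{1..q - 1}. real_of_int q / of_int j)"
      by (rule sum.reindex_bij_witness[where i = "\<lambda>j. q - j" and j = "\<lambda>j. q - j"]) auto
    then have "(\<Sum>j\<in>{1..q - 1}. w j) = 2 * (\<Sum>j\<in>{1..q - 1}. real_of_int q / of_int j)"
      by (simp add: w_def sum.distrib)
    also have "\<dots> = 2 * of_int q * (\<Sum>j\<in>{1..q - 1}. 1 / of_int j)"
      by (simp add: sum_distrib_left)
    also have "\<dots> \<le> 2 * of_int q * (1 + ln (of_int (q - 1)))"
      using q False by (intro mult_left_mono sum_inverse_int_le) auto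
    also have "\<dots> \<le> 2 * of_int q * (1 + ln (of_int q))"
      using q False by (intro mult_left_mono add_left_mono) auto
    finally show ?thesis .
  qed simp
  have "real (card R) = 2 * (of_int (int N div q) + 1)"
    using q by (simp add: R_def pos_imp_zdiv_nonneg_iff)
  also have "of_int (int N div q) \<le> real N / of_int q"
    using q by (metis of_int_of_nat_eq real_of_int_div4)
  finally have 3: "real (card R) \<le> 2 * (real N / of_int q + 1)" by simp
  have "real (card R) * (\<Sum>j\<in>{1..q - 1}. w j)
      \<le> 2 * (real N / of_int q + 1) * (2 * of_int q * (1 + ln (of_int q)))"
    using 2 3 q w0 by (intro mult_mono sum_nonneg) auto
  also have "2 * (real N / of_int q + 1) * (2 * of_int q * (1 + ln (of_int q)))
      = 4 * (real N + of_int q) * (1 + ln (of_int q))"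
    using q by (simp add: field_simps)
  \<comment> \<open>By q \<le> 2 N, the first factor grows to 3 N, and the logarithm by at most ln 2
    < 1, hence the factor 2.\<close>
  also have "\<dots> \<le> 4 * (3 * real N) * (2 * (1 + ln (real N)))"
  proof -
    have q2: "real_of_int q \<le> 2 * real N" using q by linarith
    have "ln (of_int q) \<le> ln (2 * real N)"
      using q2 q N by (subst ln_le_cancel_iff) auto
    also have "\<dots> = ln 2 + ln (real N)"
      using N by (simp add: ln_mult)
    also have "\<dots> \<le> 1 + ln (real N)"
      using ln_2_less_1 by simp
    finally have "ln (of_int q) \<le> 1 + ln (real N)" .
    moreover have "ln (real N) \<ge> 0" using N by simp
    ultimately have "1 + ln (of_int q) \<le> 2 * (1 + ln (real N))"
      by argo
    moreover have "ln (real_of_int q) \<ge> 0" using q by simp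
    ultimately show ?thesis
      using q2 q by (intro mult_mono) auto
  qed
  also have "\<dots> = 24 * real N * (1 + ln (real N))"
    by simp
  finally show ?thesis
    using 1 unfolding S_def by linarith
qed

section \<open>Pairs congruent modulo q, with three bounds for their contribution\<close>

lemma multiples_in_symmetric_interval:
  fixes q N :: int
  assumes "q > 0"
  shows "{h \<in> {-N..N}. q dvd h} = (\<lambda>k. k * q) ` {-(N div q)..N div q}"
proof (intro equalityI subsetI)
  fix h assume "h \<in> {h \<in> {-N..N}. q dvd h}"
  then obtain k where k: "h = k * q" "- N \<le> k * q" "k * q \<le> N"
    by (auto simp: dvd_def mult.commute)
  have "l \<le> N div q" if "l * q \<le> N" for l
    using zdiv_mono1[OF that assms] assms by simp
  from this[of k] this[of "- k"] have "k \<le> N div q" "- k \<le> N div q"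
    using k by auto
  then show "h \<in> (\<lambda>k. k * q) ` {-(N div q)..N div q}"
    using k by auto
next
  fix h assume "h \<in> (\<lambda>k. k * q) ` {-(N div q)..N div q}"
  then obtain k where "k \<in> {-(N div q)..N div q}" and hk: "h = k * q"
    by blast
  then have k: "- k \<le> N div q" "k \<le> N div q"
    by auto
  have *: "l * q \<le> N" if "l \<le> N div q" for l
  proof -
    have "l * q \<le> (N div q) * q" using that assms by (intro mult_right_mono) auto
    also have "\<dots> \<le> N"
      using pos_mod_sign[OF assms, of N] div_mult_mod_eq[of N q] by linarith
    finally show ?thesis .
  qed
  show "h \<in> {h \<in> {-N..N}. q dvd h}"
    using *[OF k(1)] *[OF k(2)] hk by auto
qed

text \<open>The main part of |G|^2: it must be large when |G| is, which the three bounds below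
  convert into constraints on q, y and x.\<close>

definition diag_sum :: "real \<Rightarrow> real \<Rightarrow> nat \<Rightarrow> int \<Rightarrow> complex" where
  "diag_sum x y N q = (\<Sum>p\<in>{p \<in> {1..int N} \<times> {1..int N}. q dvd fst p - snd p}.
      qphase x y (fst p) * cnj (qphase x y (snd p)))"

text \<open>|G|^2 is a double sum over pairs, split according to whether q divides the difference;
  the non-multiples are controlled by geometric sums.\<close>

lemma norm_gauss_sum_square_le:
  fixes a q :: int and N :: nat
  assumes q: "0 < q" "q \<le> 2 * int N" and cop: "coprime a q"
    and close: "\<bar>of_int q * (2 * y) - of_int a\<bar> \<le> 1 / (2 * real N)"
  shows "(norm (gauss_sum x y N))\<^sup>2 \<le> norm (diag_sum x y N q) + 24 * real N * (1 + ln (real N))"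
proof -
  define F where "F = qphase x y"
  define I where "I = {1..int N}"
  define f where "f p = F (fst p) * cnj (F (snd p))" for p
  define off where "off = (\<Sum>p\<in>{p \<in> I \<times> I. \<not> q dvd fst p - snd p}. f p)"
  have "of_real ((norm (gauss_sum x y N))\<^sup>2) = gauss_sum x y N * cnj (gauss_sum x y N)"
    by (rule complex_norm_square)
  also have "\<dots> = (\<Sum>p\<in>I \<times> I. f p)"
    by (simp add: gauss_sum_eq sum_product sum.cartesian_product case_prod_beta f_def I_def F_def)
  also have "I \<times> I = {p \<in> I \<times> I. q dvd fst p - snd p} \<union> {p \<in> I \<times> I. \<not> q dvd fst p - snd p}"
    by auto
  also have "(\<Sum>p\<in>\<dots>. f p) = diag_sum x y N q + off"
    unfolding off_def by (subst sum.union_disjoint) (auto simp: diag_sum_def f_def I_def F_def)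
  finally have "(norm (gauss_sum x y N))\<^sup>2 = norm (diag_sum x y N q + off)"
    by (metis norm_of_real abs_of_nonneg zero_le_power2)
  also have "\<dots> \<le> norm (diag_sum x y N q) + norm off"
    by (rule norm_triangle_ineq)
  also have "norm off \<le> (\<Sum>h\<in>{h \<in> {- int N..int N}. \<not> q dvd h}. 2 / norm (1 - e_fn (2 * y * of_int h)))"
    unfolding off_def f_def I_def F_def
  proof (rule norm_sum_correlations_le)
    fix h assume h: "\<not> q dvd h" "\<bar>h\<bar> \<le> int N"
    have "real_of_int \<bar>h\<bar> \<le> real N" using h by linarith
    then have "\<bar>of_int h\<bar> * \<bar>of_int q * (2 * y) - of_int a\<bar> \<le> real N * (1 / (2 * real N))"
      using close by (intro mult_mono) auto
    also have "\<dots> \<le> 1 / 2" by simp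
    finally have "\<bar>of_int h * (of_int q * (2 * y) - of_int a)\<bar> \<le> 1 / 2"
      by (simp add: abs_mult)
    then have "e_fn (2 * y * of_int h) \<noteq> 1"
      by (rule inverse_norm_one_minus_e_fn_le(2)[OF q(1) cop h(1)])
    then show "norm (\<Sum>n = max 1 (1 - h)..min (int N) (int N - h). qphase x y (n + h) * cnj (qphase x y n))
        \<le> 2 / norm (1 - e_fn (2 * y * of_int h))"
      by (rule norm_qphase_correlation_le)
  qed
  also have "\<dots> \<le> 24 * real N * (1 + ln (real N))"
    by (rule sum_off_diagonal_le[OF q cop close])
  finally show ?thesis by simp
qed

text \<open>Trivial count, at most N for each multiple of q in [-N, N]. It will bound q from
  above.\<close>

lemma norm_diag_sum_le_card:
  assumes q: "0 < q"
  shows "norm (diag_sum x y N q) \<le> real N * (2 * real N / of_int q + 1)"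
proof -
  have "norm (diag_sum x y N q) \<le> (\<Sum>h\<in>{h \<in> {- int N..int N}. q dvd h}. real N)"
    unfolding diag_sum_def by (intro norm_sum_correlations_le norm_qphase_correlation_le_card)
  also have "\<dots> = real N * real (card {h \<in> {- int N..int N}. q dvd h})"
    by simp
  also have "card {h \<in> {- int N..int N}. q dvd h} \<le> card {- (int N div q)..int N div q}"
    unfolding multiples_in_symmetric_interval[OF q] by (intro card_image_le) simp
  also have "real (card {- (int N div q)..int N div q}) = 2 * of_int (int N div q) + 1"
    using q by (simp add: pos_imp_zdiv_nonneg_iff)
  also have "of_int (int N div q) \<le> real N / of_int q"
    by (metis of_int_of_nat_eq real_of_int_div4)
  finally show ?thesis by (simp add: mult_left_mono)
qed

text \<open>For h = k q the frequency 2 y h is, modulo 1, k times the approximation error, and still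
  at most 1/2 in modulus. The geometric sums then decay like 1/|k| and add up to a
  logarithm.\<close>

lemma norm_diag_sum_le_inverse:
  fixes a q :: int
  assumes q: "0 < q" and N: "N > 0"
    and close: "\<bar>of_int q * (2 * y) - of_int a\<bar> \<le> 1 / (2 * real N)"
    and nz: "of_int q * (2 * y) \<noteq> of_int a"
  shows "norm (diag_sum x y N q) \<le> real N + (1 + ln (real N)) / \<bar>of_int q * (2 * y) - of_int a\<bar>"
proof -
  define \<tau> where "\<tau> = \<bar>of_int q * (2 * y) - of_int a\<bar>"
  \<comment> \<open>The case k = 0 is the diagonal m = n; the other values are 2 / (4 |k| \<tau>)
    from the geometric sum.\<close>
  define B where "B k = (if k = 0 then real N else 1 / (2 * \<bar>of_int k\<bar> * \<tau>))" for k :: int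
  have \<tau>: "\<tau> > 0" using nz by (simp add: \<tau>_def)
  have B0: "B k \<ge> 0" for k using \<tau> by (simp add: B_def)
  define K where "K = int N div q"
  have "K * 1 \<le> K * q"
    using q by (intro mult_left_mono) (auto simp: K_def pos_imp_zdiv_nonneg_iff)
  also have "K * q \<le> int N"
    using pos_mod_sign[OF q, of "int N"] div_mult_mod_eq[of "int N" q] unfolding K_def by linarith
  finally have KN: "K \<le> int N" by simp
  have "norm (diag_sum x y N q) \<le> (\<Sum>h\<in>{h \<in> {- int N..int N}. q dvd h}. B (h div q))"
    unfolding diag_sum_def
  proof (rule norm_sum_correlations_le)
    fix h assume h: "q dvd h" "\<bar>h\<bar> \<le> int N"
    then obtain k where k: "h = k * q" by (auto simp: dvd_def mult.commute)
    have "\<bar>k\<bar> * 1 \<le> \<bar>k\<bar> * q" using q by (intro mult_left_mono) auto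
    also have "\<dots> = \<bar>h\<bar>" using q by (simp add: k abs_mult)
    finally have kN: "\<bar>k\<bar> \<le> int N" using h by simp
    let ?c = "norm (\<Sum>n = max 1 (1 - h)..min (int N) (int N - h). qphase x y (n + h) * cnj (qphase x y n))"
    show "?c \<le> B (h div q)"
    proof (cases "k = 0")
      case True
      then show ?thesis using norm_qphase_correlation_le_card[of x y h N] k by (simp add: B_def)
    next
      case False
      define s where "s = of_int k * (of_int q * (2 * y) - of_int a)"
      have s: "\<bar>s\<bar> = \<bar>of_int k\<bar> * \<tau>" by (simp add: s_def \<tau>_def abs_mult)
      have "real_of_int \<bar>k\<bar> \<le> real N" using kN by linarith
      then have "\<bar>s\<bar> \<le> real N * (1 / (2 * real N))"
        unfolding s using close \<tau> by (intro mult_mono) (auto simp: \<tau>_def)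
      then have "\<bar>s\<bar> \<le> 1 / 2" using N by simp
      then have "norm (1 - e_fn s) \<ge> 4 * \<bar>s\<bar>" by (rule norm_one_minus_e_fn_ge)
      moreover have "2 * y * of_int h = s + of_int (k * a)"
        by (simp add: s_def k algebra_simps)
      ultimately have ge: "norm (1 - e_fn (2 * y * of_int h)) \<ge> 4 * \<bar>s\<bar>"
        by (simp only: norm_one_minus_e_fn_add_int)
      have spos: "\<bar>s\<bar> > 0" using False \<tau> by (simp add: s)
      then have "e_fn (2 * y * of_int h) \<noteq> 1" using ge by auto
      then have "?c \<le> 2 / norm (1 - e_fn (2 * y * of_int h))"
        by (rule norm_qphase_correlation_le)
      also have "\<dots> \<le> 2 / (4 * \<bar>s\<bar>)"
        using ge spos by (intro frac_le) auto
      also have "\<dots> = B (h div q)"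
        using False q by (simp add: B_def k s)
      finally show ?thesis .
    qed
  qed
  also have "\<dots> = (\<Sum>k\<in>{- K..K}. B k)"
    unfolding multiples_in_symmetric_interval[OF q] K_def
    using q by (subst sum.reindex) (auto simp: inj_on_def)
  \<comment> \<open>The larger range makes the harmonic sum independent of q, including q > N, where
    K = 0.\<close>
  also have "\<dots> \<le> (\<Sum>k\<in>{- int N..int N}. B k)"
    using KN B0 by (intro sum_mono2) auto
  also have "{- int N..int N} = insert 0 ({1..int N} \<union> uminus ` {1..int N})"
    by (auto simp: image_iff)
  also have "(\<Sum>k\<in>\<dots>. B k) = B 0 + ((\<Sum>k\<in>{1..int N}. B k) + (\<Sum>k\<in>uminus ` {1..int N}. B k))"
    by (subst sum.insert, simp, force, subst sum.union_disjoint) auto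
  also have "(\<Sum>k\<in>uminus ` {1..int N}. B k) = (\<Sum>k\<in>{1..int N}. B k)"
    by (subst sum.reindex) (auto simp: B_def)
  also have "(\<Sum>k\<in>{1..int N}. B k) = (\<Sum>k\<in>{1..int N}. 1 / of_int k) / (2 * \<tau>)"
    by (simp add: sum_divide_distrib B_def mult_ac)
  also have "(\<Sum>k\<in>{1..int N}. 1 / real_of_int k) \<le> 1 + ln (real N)"
    using sum_inverse_int_le[of "int N"] N by simp
  finally show ?thesis using \<tau> by (simp add: B_def \<tau>_def divide_right_mono)
qed

text \<open>The diagonal part is the sum of the squared moduli of the class sums. In each square one
  factor is bounded by B and the other by the size of the class; the sizes add up to N.\<close>

lemma norm_diag_sum_le_classes:
  assumes q: "0 < q"
    and B: "\<And>r. norm (\<Sum>n\<in>{n \<in> {1..int N}. n mod q = r}. qphase x y n) \<le> B"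
  shows "norm (diag_sum x y N q) \<le> B * real N"
proof -
  define I where "I r = {n \<in> {1..int N}. n mod q = r}" for r
  define S where "S = {p \<in> {1..int N} \<times> {1..int N}. q dvd fst p - snd p}"
  define f where "f p = qphase x y (fst p) * cnj (qphase x y (snd p))" for p
  have finS: "finite S"
    unfolding S_def by (intro finite_Collect_conjI disjI1) simp
  have "diag_sum x y N q = (\<Sum>r\<in>{0..<q}. \<Sum>p\<in>{p. p \<in> S \<and> fst p mod q = r}. f p)"
    unfolding diag_sum_def S_def[symmetric] f_def[symmetric]
    using finS q by (intro sum.group[symmetric]) auto
  also have "\<dots> = (\<Sum>r\<in>{0..<q}. (\<Sum>n\<in>I r. qphase x y n) * cnj (\<Sum>n\<in>I r. qphase x y n))"
  proof (rule sum.cong[OF refl])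
    fix r
    have "{p. p \<in> S \<and> fst p mod q = r} = I r \<times> I r"
      by (auto simp: S_def I_def mod_eq_dvd_iff[symmetric])
    then show "(\<Sum>p\<in>{p. p \<in> S \<and> fst p mod q = r}. f p)
        = (\<Sum>n\<in>I r. qphase x y n) * cnj (\<Sum>n\<in>I r. qphase x y n)"
      by (simp add: sum_product sum.cartesian_product case_prod_beta f_def)
  qed
  also have "norm \<dots> \<le> (\<Sum>r\<in>{0..<q}. B * real (card (I r)))"
  proof (intro sum_norm_le)
    fix r
    have "norm (\<Sum>n\<in>I r. qphase x y n) \<le> (\<Sum>n\<in>I r. 1)"
      by (intro sum_norm_le) simp
    then have "norm (\<Sum>n\<in>I r. qphase x y n) * norm (\<Sum>n\<in>I r. qphase x y n) \<le> B * real (card (I r))"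
      using B[of r] order_trans[OF norm_ge_zero B[of r]]
      unfolding I_def[symmetric] by (intro mult_mono) auto
    then show "norm ((\<Sum>n\<in>I r. qphase x y n) * cnj (\<Sum>n\<in>I r. qphase x y n)) \<le> B * real (card (I r))"
      by (simp only: norm_mult complex_mod_cnj)
  qed
  also have "\<dots> = B * (\<Sum>r\<in>{0..<q}. \<Sum>n\<in>I r. 1)"
    by (simp add: sum_distrib_left)
  also have "(\<Sum>r\<in>{0..<q}. \<Sum>n\<in>I r. 1) = (\<Sum>n\<in>{1..int N}. 1 :: real)"
    unfolding I_def using q by (intro sum.group) auto
  finally show ?thesis by simp
qed

text \<open>With \<open>2 y = (a + \<tau>) / q\<close>, passing from \<open>n\<close> to \<open>n + q\<close> changes the phase, modulo 1, by
  \<open>q x + a q / 2\<close> plus the small and slowly varying \<open>\<tau> (n + q / 2)\<close>.\<close>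

lemma norm_residue_class_sum_le:
  fixes a b q :: int and x y :: real
  assumes q: "0 < q" "q \<le> int N"
  defines "\<tau> \<equiv> of_int q * (2 * y) - of_int a"
    and "\<eta> \<equiv> \<bar>of_int q * x + of_int a * of_int q / 2 - of_int b\<bar>"
  assumes \<eta>: "0 < \<eta>" "\<eta> \<le> 1 / 2" and \<tau>: "6 * real N * \<bar>\<tau>\<bar> \<le> \<eta>"
  shows "norm (\<Sum>n\<in>{n \<in> {1..int N}. n mod q = r}. qphase x y n) \<le> 2 / \<eta>"
proof (cases "{n \<in> {1..int N}. n mod q = r} = {}")
  case True
  then show ?thesis using \<eta> by (metis divide_nonneg_pos norm_zero sum.empty zero_le_numeral)
next
  case False
  then have r: "0 \<le> r" "r < q" using q by auto
  define \<theta> where "\<theta> = of_int q * x + of_int a * of_int q / 2 - of_int b"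
  have \<theta>: "\<bar>\<theta>\<bar> = \<eta>" by (simp add: \<theta>_def \<eta>_def)
  \<comment> \<open>The least positive member of the class: the range starts at 1, so class 0 starts
    at q.\<close>
  define n0 where "n0 = (if r = 0 then q else r)"
  have n0: "1 \<le> n0" "n0 \<le> q" "n0 mod q = r" using r by (auto simp: n0_def)
  define M where "M = nat ((int N - n0) div q)"
  have intM: "int M = (int N - n0) div q"
    using n0 q by (simp add: M_def pos_imp_zdiv_nonneg_iff)
  have Mq: "n0 + q * int M \<le> int N"
    using pos_mod_sign[OF q(1), of "int N - n0"] mult_div_mod_eq[of q "int N - n0"] unfolding intM by linarith
  define nn where "nn m = n0 + q * int m" for m
  have nn1: "nn m \<ge> 1" for m using n0 q by (simp add: nn_def add_pos_nonneg int_one_le_iff_zero_less)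
  have nnN: "nn m \<le> int N" if "m \<le> M" for m
  proof -
    have "q * int m \<le> q * int M" using that q by (intro mult_left_mono) auto
    then show ?thesis using Mq by (simp add: nn_def)
  qed
  have cls: "{n \<in> {1..int N}. n mod q = r} = nn ` {..M}"
  proof (intro equalityI subsetI)
    fix n assume n: "n \<in> {n \<in> {1..int N}. n mod q = r}"
    then have "q dvd n - n0" using n0 by (auto simp: mod_eq_dvd_iff[symmetric])
    then obtain k where k: "n - n0 = q * k" by (auto simp: dvd_def)
    \<comment> \<open>With n \<ge> 1 and \<open>n0 \<le> q\<close>, no negative k is
      possible.\<close>
    have "- q < q * k" using n n0 k by auto
    then have "k > - 1" using q mult_le_cancel_left_pos[of q k "-1"] by force
    moreover have "k \<le> (int N - n0) div q"
      using zdiv_mono1[of "q * k" "int N - n0" q] n k q by auto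
    ultimately have "nat k \<le> M" "n = nn (nat k)"
      using k by (auto simp: nn_def M_def)
    then show "n \<in> nn ` {..M}" by auto
  next
    fix n assume "n \<in> nn ` {..M}"
    then show "n \<in> {n \<in> {1..int N}. n mod q = r}"
      using nn1 nnN n0 by (auto simp: nn_def)
  qed
  have inj: "inj_on nn {..M}" using q by (auto simp: inj_on_def nn_def)
  define u where "u m = qphase x y (nn m)" for m
  define s where "s m = \<tau> * (of_int (nn m) + of_int q / 2)" for m
  define v where "v m = e_fn (\<theta> + s m)" for m
  have step: "u (Suc m) = u m * v m" for m
  proof -
    have nnS: "nn (Suc m) = nn m + q" by (simp add: nn_def algebra_simps)
    \<comment> \<open>Expansion with 2 y q = a + \<tau>; the integer \<open>b + a * nn m\<close>
      disappears under \<open>e_fn\<close>.\<close>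
    have "x * of_int (nn m + q) + y * (of_int (nn m + q))\<^sup>2
        = (x * of_int (nn m) + y * (of_int (nn m))\<^sup>2 + (\<theta> + s m)) + of_int (b + a * nn m)"
      by (simp add: \<theta>_def s_def \<tau>_def power2_eq_square field_simps)
    then show ?thesis
      by (simp only: u_def v_def qphase_def nnS e_fn_add e_fn_of_int) simp
  qed
  \<comment> \<open>The constant 6 in the hypothesis on \<tau> is 4 * 3/2, as \<open>nn m\<close> +
    q/2 is at most 3 N / 2.\<close>
  have s: "\<bar>s m\<bar> \<le> \<eta> / 4" if "m \<le> M" for m
  proof -
    have "real_of_int (nn m) \<ge> 0" "real_of_int (nn m) \<le> real N" "real_of_int q \<le> real N"
      using nn1[of m] nnN[OF that] q by linarith+
    then have "\<bar>of_int (nn m) + of_int q / 2\<bar> \<le> 3 / 2 * real N"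
      using q by simp
    then have "\<bar>s m\<bar> \<le> \<bar>\<tau>\<bar> * (3 / 2 * real N)"
      unfolding s_def abs_mult by (intro mult_left_mono) auto
    then show ?thesis using \<tau> by (simp add: algebra_simps)
  qed
  \<comment> \<open>Jordan's inequality gives 4 \<eta> for the constant slope \<theta>; the
    perturbation costs at most 2 \<eta>.\<close>
  have d: "norm (1 - v m) \<ge> 2 * \<eta>" if "m \<le> M" for m
  proof -
    have "4 * \<eta> \<le> norm (1 - e_fn \<theta>)"
      using norm_one_minus_e_fn_ge[of \<theta>] \<eta> \<theta> by simp
    also have "\<dots> \<le> norm (1 - v m) + norm (v m - e_fn \<theta>)"
      by (metis norm_triangle_ineq add.commute diff_add_cancel add_diff_eq)
    also have "norm (v m - e_fn \<theta>) \<le> 2 * pi * \<bar>s m\<bar>"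
      using norm_e_fn_diff_le[of "\<theta> + s m" \<theta>] by (simp add: v_def)
    also have "\<dots> \<le> 2 * 4 * (\<eta> / 4)"
      using s[OF that] pi_less_4 by (intro mult_mono) auto
    finally show ?thesis by simp
  qed
  have \<kappa>: "norm (v (Suc m) - v m) \<le> 2 * pi * (\<bar>\<tau>\<bar> * of_int q)" for m
  proof -
    have "s (Suc m) - s m = \<tau> * of_int q"
      by (simp add: s_def nn_def algebra_simps)
    then show ?thesis
      using norm_e_fn_diff_le[of "\<theta> + s (Suc m)" "\<theta> + s m"] q by (simp add: v_def abs_mult)
  qed
  have "norm (\<Sum>n\<in>{n \<in> {1..int N}. n mod q = r}. qphase x y n) = norm (\<Sum>m\<le>M. u m)"
    unfolding cls by (simp add: sum.reindex[OF inj] u_def)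
  also have "\<dots> \<le> (2 + M * (2 * pi * (\<bar>\<tau>\<bar> * of_int q)) / (2 * \<eta>)) / (2 * \<eta>)"
    by (rule norm_sum_unimodular_le[where v = v]) (use step d \<kappa> \<eta> in \<open>auto simp: u_def\<close>)
  \<comment> \<open>Since q M \<le> N, the total variation of v is at most 2 pi N |\<tau>|, small
    compared with \<eta>.\<close>
  also have "\<dots> \<le> (2 + 2) / (2 * \<eta>)"
  proof -
    have "real_of_int (q * int M) \<le> of_int (int N)"
      using Mq n0 by (subst of_int_le_iff) linarith
    then have "(real M * of_int q) * \<bar>\<tau>\<bar> \<le> real N * \<bar>\<tau>\<bar>"
      by (intro mult_right_mono) (auto simp: mult.commute)
    also have "\<dots> \<le> \<eta> / 6" using \<tau> by simp
    finally have "2 * pi * ((real M * of_int q) * \<bar>\<tau>\<bar>) \<le> 2 * 4 * (\<eta> / 6)"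
      using pi_less_4 q by (intro mult_mono) auto
    also have "\<dots> \<le> 4 * \<eta>" using \<eta> by simp
    finally have "M * (2 * pi * (\<bar>\<tau>\<bar> * of_int q)) / (2 * \<eta>) \<le> 2"
      using \<eta> by (simp add: field_simps)
    then show ?thesis using \<eta> by (intro divide_right_mono add_left_mono) auto
  qed
  finally show ?thesis by simp
qed

section \<open>Large values of the quadratic sum\<close>

text \<open>Dirichlet's theorem supplies a/q near 2 y. The diagonal part is then large, and its
  three upper bounds limit in turn q, the error in y and the error in x.\<close>

lemma gauss_sum_large_approx:
  assumes N: "N > 0" and A: "A > 0" "A \<le> norm (gauss_sum x y N)"
    and large: "50 * real N * (1 + ln (real N)) \<le> A\<^sup>2"
  obtains q a b :: int where "0 < q" "real_of_int q \<le> 4 * (real N)\<^sup>2 / A\<^sup>2"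
    "\<bar>2 * of_int q * y - of_int a\<bar> \<le> 2 * (1 + ln (real N)) / A\<^sup>2"
    "\<bar>2 * of_int q * x - of_int b\<bar> \<le> 24 * real N * (1 + ln (real N)) / A\<^sup>2"
proof -
  define L where "L = 1 + ln (real N)"
  have L: "L \<ge> 1" using N by (simp add: L_def)
  have NL: "real N \<le> real N * L" using L N by simp
  obtain a q where cop: "coprime a q" and q: "0 < q" "q \<le> int (2 * N)"
    and close: "\<bar>of_int q * (2 * y) - of_int a\<bar> < 1 / real (2 * N)"
    using Dirichlet_approx_coprime[of "2 * N" "2 * y"] N by auto
  define \<tau> where "\<tau> = of_int q * (2 * y) - of_int a"
  have close': "\<bar>of_int q * (2 * y) - of_int a\<bar> \<le> 1 / (2 * real N)" using close by simp
  have A2: "A\<^sup>2 > 0" using A by simp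
  have "A\<^sup>2 \<le> (norm (gauss_sum x y N))\<^sup>2" using A by (intro power_mono) auto
  also have "\<dots> \<le> norm (diag_sum x y N q) + 24 * real N * L"
    unfolding L_def using q by (intro norm_gauss_sum_square_le[OF _ _ cop close']) auto
  \<comment> \<open>Here 50 = 2 * (24 + 1); the spare N L absorbs the summand N in the first two
    diagonal bounds.\<close>
  finally have D: "norm (diag_sum x y N q) \<ge> A\<^sup>2 / 2 + real N * L"
    using large unfolding L_def[symmetric] by (simp add: algebra_simps)
  have q_le: "real_of_int q \<le> 4 * (real N)\<^sup>2 / A\<^sup>2"
  proof -
    have "real N * (2 * real N / of_int q + 1) = 2 * ((real N)\<^sup>2 / of_int q) + real N"
      by (simp add: power2_eq_square algebra_simps)
    then have "A\<^sup>2 / 2 \<le> 2 * ((real N)\<^sup>2 / of_int q)"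
      using norm_diag_sum_le_card[OF q(1), of x y N] D NL by linarith
    then show ?thesis using q A2 by (simp add: field_simps)
  qed
  \<comment> \<open>Dirichlet only gives q \<le> 2 N, while the residue class bound asks for q \<le>
    N.\<close>
  have qN: "q \<le> int N"
  proof -
    have "4 * real N \<le> 50 * real N * L" using NL L N by (simp add: algebra_simps)
    then have "4 * (real N)\<^sup>2 \<le> real N * A\<^sup>2"
      using large mult_left_mono[of "4 * real N" "A\<^sup>2" "real N"] unfolding L_def[symmetric] power2_eq_square[of "real N"]
      by linarith
    then have "4 * (real N)\<^sup>2 / A\<^sup>2 \<le> real N" using A2 by (simp add: field_simps)
    then show ?thesis using q_le by linarith
  qed
  have \<tau>_le: "\<bar>\<tau>\<bar> \<le> 2 * L / A\<^sup>2"
  proof (cases "\<tau> = 0")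
    case False
    then have "norm (diag_sum x y N q) \<le> real N + L / \<bar>\<tau>\<bar>"
      using norm_diag_sum_le_inverse[OF q(1) N close', of x] by (simp add: \<tau>_def L_def)
    then have "A\<^sup>2 / 2 \<le> L / \<bar>\<tau>\<bar>"
      using D NL by linarith
    then show ?thesis using False A2 by (simp add: field_simps)
  qed (use L in simp)
  define \<theta> where "\<theta> = of_int q * x + of_int a * of_int q / 2"
  define \<eta> where "\<eta> = \<bar>\<theta> - of_int (round \<theta>)\<bar>"
  \<comment> \<open>If \<eta> were larger, the bound on \<tau> would make the class sums applicable;
    they give \<eta> \<le> 4 N / A^2, a contradiction.\<close>
  have \<eta>_le: "\<eta> \<le> 12 * real N * L / A\<^sup>2"
  proof (rule ccontr)
    assume "\<not> \<eta> \<le> 12 * real N * L / A\<^sup>2"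
    then have big: "\<eta> > 12 * real N * L / A\<^sup>2" by simp
    moreover have "12 * real N * L / A\<^sup>2 \<ge> 0" using L by simp
    ultimately have pos: "\<eta> > 0" by linarith
    have "\<eta> \<le> 1 / 2"
      using of_int_round_abs_le[of \<theta>] by (simp add: \<eta>_def abs_minus_commute)
    moreover have "6 * real N * \<bar>\<tau>\<bar> \<le> 6 * real N * (2 * L / A\<^sup>2)"
      using \<tau>_le by (intro mult_left_mono) auto
    then have "6 * real N * \<bar>\<tau>\<bar> \<le> \<eta>" using big by simp
    ultimately have "norm (diag_sum x y N q) \<le> 2 / \<eta> * real N"
      using pos q qN unfolding \<tau>_def \<eta>_def \<theta>_def
      by (intro norm_diag_sum_le_classes norm_residue_class_sum_le) auto
    then have "A\<^sup>2 / 2 \<le> 2 / \<eta> * real N" using D NL by linarith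
    then have "\<eta> \<le> 4 * real N / A\<^sup>2" using pos A2 by (simp add: field_simps)
    also have "\<dots> \<le> 12 * real N * L / A\<^sup>2"
    proof (rule divide_right_mono)
      show "4 * real N \<le> 12 * real N * L" using NL by linarith
    qed (use A2 in simp)
    finally show False using big by simp
  qed
  show thesis
  proof (rule that[OF q(1) q_le])
    show "\<bar>2 * of_int q * y - of_int a\<bar> \<le> 2 * (1 + ln (real N)) / A\<^sup>2"
      using \<tau>_le by (simp add: \<tau>_def L_def mult.assoc mult.left_commute)
    \<comment> \<open>Doubling clears the half-integer a q / 2 in \<theta> and turns 12 into
      24.\<close>
    have "2 * of_int q * x - of_int (2 * round \<theta> - a * q) = 2 * (\<theta> - of_int (round \<theta>))"
      by (simp add: \<theta>_def algebra_simps)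
    then show "\<bar>2 * of_int q * x - of_int (2 * round \<theta> - a * q)\<bar> \<le> 24 * real N * (1 + ln (real N)) / A\<^sup>2"
      using \<eta>_le by (simp add: \<eta>_def L_def abs_mult)
  qed
qed

text \<open>The majorant counts intervals around the points (b + t a) / (2 q). Each q up to Q, of
  order N^2 / A^2, has O(q^2) pairs (a, b) and intervals of length W / q, so the integral is O(Q^2
  W).\<close>

lemma exists_large_values_majorant:
  assumes N: "N > 0" and A: "A > 0" and large: "50 * real N * (1 + ln (real N)) \<le> A\<^sup>2"
  obtains g :: "real \<Rightarrow> real" where "integrable lborel g" "\<And>z. 0 \<le> g z"
    "\<And>x y. (x, y) \<in> unit_square \<Longrightarrow> A \<le> norm (gauss_sum x y N) \<Longrightarrow> 1 \<le> g (x + t * y)"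
    "(LINT z|lborel. g z) \<le> 784 * (24 + 2 * \<bar>t\<bar>) * (1 + ln (real N)) * real N ^ 5 / A ^ 6"
proof -
  define L where "L = 1 + ln (real N)"
  have L: "L \<ge> 1" using N by (simp add: L_def)
  have A2: "A\<^sup>2 > 0" using A by simp
  have NL: "real N * 1 \<le> real N * L" using L N by (intro mult_left_mono) auto
  \<comment> \<open>The error in x plus |t| times the error in y, the latter enlarged by a factor
    N.\<close>
  define W where "W = (24 + 2 * \<bar>t\<bar>) * real N * L / A\<^sup>2"
  have W: "W \<ge> 0" using L by (simp add: W_def)
  define Q where "Q = \<lfloor>4 * (real N)\<^sup>2 / A\<^sup>2\<rfloor>"
  define I where "I q a b = {(of_int b + t * of_int a - W) / (2 * of_int q)..(of_int b + t * of_int a + W) / (2 * of_int q)}"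
    for q a b :: int
  \<comment> \<open>Points of the unit square lead to -1 \<le> a, b \<le> 2 q + 1, which lies within
    [-3 q, 3 q].\<close>
  define g :: "real \<Rightarrow> real" where
    "g z = (\<Sum>q\<in>{1..Q}. \<Sum>a\<in>{-3*q..3*q}. \<Sum>b\<in>{-3*q..3*q}. indicat_real (I q a b) z)" for z
  have int: "integrable lborel (indicat_real (I q a b))" for q a b
    unfolding I_def using emeasure_lborel_Icc_eq by (intro integrable_real_indicator) auto
  have LI: "(LINT z|lborel. indicat_real (I q a b) z) = W / of_int q" if "q \<ge> 1" for q a b
  proof -
    have "(of_int b + t * of_int a - W) / (2 * of_int q) \<le> (of_int b + t * of_int a + W) / (2 * of_int q)"
      using W that by (intro divide_right_mono) auto
    then show ?thesis using that by (simp add: I_def field_simps)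
  qed
  show thesis
  proof (rule that)
    show "integrable lborel g"
      unfolding g_def by (intro Bochner_Integration.integrable_sum int)
    show "0 \<le> g z" for z
      unfolding g_def by (intro sum_nonneg) auto
  next
    fix x y assume xy: "(x, y) \<in> unit_square" and G: "A \<le> norm (gauss_sum x y N)"
    obtain q a b :: int where q: "0 < q" "real_of_int q \<le> 4 * (real N)\<^sup>2 / A\<^sup>2"
      and a: "\<bar>2 * of_int q * y - of_int a\<bar> \<le> 2 * L / A\<^sup>2"
      and b: "\<bar>2 * of_int q * x - of_int b\<bar> \<le> 24 * real N * L / A\<^sup>2"
      using gauss_sum_large_approx[OF N A G large] unfolding L_def by blast
    have N1: "real N \<ge> 1" using N by simp
    have LN: "L * 1 \<le> L * real N" using N1 L by (intro mult_left_mono) auto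
    \<comment> \<open>Errors of at most 1 keep a and b in the summation range.\<close>
    have sm: "24 * real N * L / A\<^sup>2 \<le> 1" "2 * L / A\<^sup>2 \<le> 1"
      using large A2 LN NL unfolding L_def[symmetric] by (simp_all add: field_simps)
    have xy': "0 \<le> x" "x \<le> 1" "0 \<le> y" "y \<le> 1" using xy by (auto simp: unit_square_def)
    have mem: "c \<in> {-3*q..3*q}" if c: "\<bar>2 * of_int q * w - of_int c\<bar> \<le> 1" and w: "0 \<le> w" "w \<le> 1" for w :: real and c :: int
    proof -
      have "2 * of_int q * w \<le> 2 * of_int q * 1" using q w by (intro mult_left_mono) auto
      moreover have "0 \<le> 2 * of_int q * w" using q w by simp
      moreover have "2 * of_int q * w - of_int c \<le> 1" "- 1 \<le> 2 * of_int q * w - of_int c"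
        using c by linarith+
      ultimately have "real_of_int c \<le> of_int (2 * q + 1)" "real_of_int (- 1) \<le> of_int c"
        unfolding of_int_add of_int_mult of_int_minus of_int_numeral of_int_1 by linarith+
      then have "c \<le> 2 * q + 1" "- 1 \<le> c" by (simp_all only: of_int_le_iff)
      then show ?thesis using q by simp
    qed
    have aT: "a \<in> {-3*q..3*q}" using a sm xy' by (intro mem[of y]) auto
    have bT: "b \<in> {-3*q..3*q}" using b sm xy' by (intro mem[of x]) auto
    have qT: "q \<in> {1..Q}" using q by (simp add: Q_def le_floor_iff)
    have "x + t * y \<in> I q a b"
    proof -
      have "\<bar>2 * of_int q * (x + t * y) - (of_int b + t * of_int a)\<bar>
          = \<bar>(2 * of_int q * x - of_int b) + t * (2 * of_int q * y - of_int a)\<bar>"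
        by (simp add: algebra_simps)
      also have "\<dots> \<le> \<bar>2 * of_int q * x - of_int b\<bar> + \<bar>t\<bar> * \<bar>2 * of_int q * y - of_int a\<bar>"
        by (metis abs_mult abs_triangle_ineq)
      also have "\<dots> \<le> 24 * real N * L / A\<^sup>2 + \<bar>t\<bar> * (2 * (L * real N) / A\<^sup>2)"
      proof -
        have "2 * L / A\<^sup>2 \<le> 2 * (L * real N) / A\<^sup>2"
          using LN A2 by (intro divide_right_mono) auto
        then have "\<bar>2 * of_int q * y - of_int a\<bar> \<le> 2 * (L * real N) / A\<^sup>2" using a by linarith
        then show ?thesis using b by (intro add_mono mult_left_mono) auto
      qed
      also have "\<dots> = W" by (simp add: W_def add_divide_distrib[symmetric]) (simp add: algebra_simps)
      finally show ?thesis using q by (auto simp: I_def field_simps abs_le_iff)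
    qed
    then have "1 = indicat_real (I q a b) (x + t * y)" by simp
    also have "\<dots> \<le> (\<Sum>b\<in>{-3*q..3*q}. indicat_real (I q a b) (x + t * y))"
      using bT by (intro member_le_sum[where f = "\<lambda>b. indicat_real (I q a b) (x + t * y)"]) auto
    also have "\<dots> \<le> (\<Sum>a\<in>{-3*q..3*q}. \<Sum>b\<in>{-3*q..3*q}. indicat_real (I q a b) (x + t * y))"
      using aT by (intro member_le_sum[where f = "\<lambda>a. \<Sum>b\<in>{-3*q..3*q}. indicat_real (I q a b) (x + t * y)"])
        (auto intro!: sum_nonneg)
    also have "\<dots> \<le> g (x + t * y)"
      unfolding g_def using qT
      by (intro member_le_sum[where f = "\<lambda>q. \<Sum>a\<in>{-3*q..3*q}. \<Sum>b\<in>{-3*q..3*q}. indicat_real (I q a b) (x + t * y)"])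
        (auto intro!: sum_nonneg)
    finally show "1 \<le> g (x + t * y)" .
  next
    have "(LINT z|lborel. g z) = (\<Sum>q\<in>{1..Q}. \<Sum>a\<in>{-3*q..3*q}. \<Sum>b\<in>{-3*q..3*q}. LINT z|lborel. indicat_real (I q a b) z)"
      unfolding g_def by (simp add: Bochner_Integration.integral_sum int)
    also have "\<dots> = (\<Sum>q\<in>{1..Q}. (6 * of_int q + 1)\<^sup>2 * (W / of_int q))"
    proof (rule sum.cong[OF refl])
      fix q assume q: "q \<in> {1..Q}"
      have "real (card {-3*q..3*q}) = 6 * of_int q + 1" using q by simp
      then show "(\<Sum>a\<in>{-3*q..3*q}. \<Sum>b\<in>{-3*q..3*q}. LINT z|lborel. indicat_real (I q a b) z)
          = (6 * of_int q + 1)\<^sup>2 * (W / of_int q)"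
        using q LI[of q] by (simp add: power2_eq_square del: card_atLeastAtMost_int)
    qed
    also have "\<dots> \<le> (\<Sum>q\<in>{1..Q}. 49 * of_int Q * W)"
    proof (rule sum_mono)
      fix q assume q: "q \<in> {1..Q}"
      have "(6 * real_of_int q + 1)\<^sup>2 \<le> (7 * of_int q)\<^sup>2" using q by (intro power_mono) auto
      then have "(6 * of_int q + 1)\<^sup>2 * (W / of_int q) \<le> (7 * of_int q)\<^sup>2 * (W / of_int q)"
        using W q by (intro mult_right_mono) auto
      also have "\<dots> = 49 * of_int q * W" using q by (simp add: power2_eq_square)
      also have "\<dots> \<le> 49 * of_int Q * W" using W q by (intro mult_right_mono) auto
      finally show "(6 * of_int q + 1)\<^sup>2 * (W / of_int q) \<le> 49 * of_int Q * W" .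
    qed
    also have "\<dots> = 49 * (of_int Q)\<^sup>2 * W"
    proof -
      have "Q \<ge> 0" by (simp add: Q_def)
      then show ?thesis by (simp add: power2_eq_square)
    qed
    \<comment> \<open>784 = 49 * 16, where 49 comes from 6 q + 1 \<le> 7 q.\<close>
    also have "\<dots> \<le> 49 * (4 * (real N)\<^sup>2 / A\<^sup>2)\<^sup>2 * W"
      using W by (intro mult_right_mono mult_left_mono power_mono) (auto simp: Q_def)
    also have "\<dots> = 784 * (24 + 2 * \<bar>t\<bar>) * (1 + ln (real N)) * real N ^ 5 / A ^ 6"
      using A by (simp add: W_def L_def[symmetric] field_simps power2_eq_square eval_nat_numeral)
    finally show "(LINT z|lborel. g z) \<le> 784 * (24 + 2 * \<bar>t\<bar>) * (1 + ln (real N)) * real N ^ 5 / A ^ 6" .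
  qed
qed

section \<open>Integration over the fibres\<close>

text \<open>The hypothesis \<open>0 \<le> B\<close> covers empty fibres, whose value is 0.\<close>

lemma fibre_sup_le:
  assumes "0 \<le> B"
    and "\<And>x y. (x, y) \<in> unit_square \<Longrightarrow> x + t * y = z \<Longrightarrow> norm (gauss_sum x y N) powr \<rho> \<le> B"
  shows "fibre_sup t \<rho> N z \<le> B"
  unfolding fibre_sup_def using assms
  by (auto simp: proj_def intro!: cSUP_least)

lemma fibre_sup_nonneg:
  assumes "\<rho> > 0"
  shows "fibre_sup t \<rho> N z \<ge> 0"
proof (cases "proj t -` {z} \<inter> unit_square = {}")
  case False
  then obtain p where p: "p \<in> proj t -` {z} \<inter> unit_square" by blast
  have "0 \<le> (case p of (x, y) \<Rightarrow> norm (gauss_sum x y N) powr \<rho>)"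
    by (simp add: case_prod_beta)
  also have "\<dots> \<le> fibre_sup t \<rho> N z"
    unfolding fibre_sup_def using False by (simp add: cSUP_upper[OF p bdd_above_fibre[OF assms]])
  finally show ?thesis .
qed (simp add: fibre_sup_def)

text \<open>Layering by J + 1 levels from N^(5/6) to N. A value between consecutive levels is
  charged to the majorant of the lower one, weighted by the \<rho>-th power of the upper one; their
  ratio produces the factor N^(\<rho> / (6 J)).\<close>

lemma integral_fibre_sup_le:
  fixes \<rho> t :: real and J N :: nat
  assumes \<rho>: "\<rho> > 0" and N: "N > 0" and J: "J > 0"
    and large: "50 * real N * (1 + ln (real N)) \<le> real N powr (5 / 3)"
  shows "(LINT z|lborel. fibre_sup t \<rho> N z)
    \<le> (1 + 2 * \<bar>t\<bar> + real J * (784 * (24 + 2 * \<bar>t\<bar>))) * (1 + ln (real N)) * real N powr (\<rho> / (6 * real J))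
        * (real N powr (5 * \<rho> / 6) + real N powr (\<rho> - 1))"
proof -
  define L where "L = 1 + ln (real N)"
  define C where "C = 784 * (24 + 2 * \<bar>t\<bar>)"
  define \<kappa> where "\<kappa> = 1 / (6 * real J)"
  define e where "e j = 5 / 6 + real j * \<kappa>" for j
  define A where "A j = real N powr e j" for j
  define X where "X = real N powr (5 * \<rho> / 6)"
  define Y where "Y = real N powr (\<rho> - 1)"
  define K where "K = real N powr (\<kappa> * \<rho>)"
  have L: "L \<ge> 1" using N by (simp add: L_def)
  have \<kappa>: "\<kappa> > 0" using J by (simp add: \<kappa>_def)
  have N1: "real N \<ge> 1" using N by simp
  have eJ: "e J = 1" using J by (simp add: e_def \<kappa>_def)
  have emono: "e i \<le> e j" if "i \<le> j" for i j using that \<kappa> by (simp add: e_def)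
  have K1: "K \<ge> 1" unfolding K_def using N1 \<kappa> \<rho> by (intro ge_one_powr_ge_zero) auto
  have Apos: "A j > 0" for j using N by (simp add: A_def)
  \<comment> \<open>The assumption is exactly the case of the lowest level, whose square is
    N^(5/3).\<close>
  have "50 * real N * (1 + ln (real N)) \<le> (A j)\<^sup>2" for j
  proof -
    have "real N powr (5 / 3) \<le> real N powr (2 * e j)"
      using N1 emono[of 0 j] by (intro powr_mono) (auto simp: e_def)
    also have "\<dots> = (A j)\<^sup>2"
      using N by (simp add: A_def powr_numeral[symmetric] powr_powr mult.commute)
    finally show ?thesis using large by simp
  qed
  then have "\<exists>g. integrable lborel g \<and> (\<forall>z. 0 \<le> g z)
      \<and> (\<forall>x y. (x, y) \<in> unit_square \<longrightarrow> A j \<le> norm (gauss_sum x y N) \<longrightarrow> 1 \<le> g (x + t * y))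
      \<and> (LINT z|lborel. g z) \<le> C * L * real N ^ 5 / A j ^ 6" for j
    using exists_large_values_majorant[OF N Apos[of j], of t] unfolding C_def L_def by metis
  then obtain g where g: "\<And>j. integrable lborel (g j)" "\<And>j z. 0 \<le> g j z"
      "\<And>j x y. (x, y) \<in> unit_square \<Longrightarrow> A j \<le> norm (gauss_sum x y N) \<Longrightarrow> 1 \<le> g j (x + t * y)"
      "\<And>j. (LINT z|lborel. g j z) \<le> C * L * real N ^ 5 / A j ^ 6"
    by metis
  \<comment> \<open>The first term covers values below the lowest level; the projection of the unit
    square lies in [-|t|, 1 + |t|].\<close>
  define H where "H z = X * indicat_real {-\<bar>t\<bar>..1 + \<bar>t\<bar>} z + (\<Sum>j<J. A (Suc j) powr \<rho> * g j z)" for z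
  have intH: "integrable lborel H"
    unfolding H_def using g(1)
    by (intro Bochner_Integration.integrable_add Bochner_Integration.integrable_sum integrable_mult_right) auto
  have le: "fibre_sup t \<rho> N z \<le> H z" for z
  proof (rule fibre_sup_le)
    have S0: "(\<Sum>j<J. A (Suc j) powr \<rho> * g j z) \<ge> 0"
      using g(2) by (intro sum_nonneg) auto
    have X0: "X * indicat_real {-\<bar>t\<bar>..1 + \<bar>t\<bar>} z \<ge> 0" by (simp add: X_def)
    show "0 \<le> H z" unfolding H_def using S0 X0 by simp
    fix x y assume xy: "(x, y) \<in> unit_square" and z: "x + t * y = z"
    let ?G = "norm (gauss_sum x y N)"
    show "?G powr \<rho> \<le> H z"
    proof (cases "?G < A 0")
      case True
      have "?G powr \<rho> \<le> A 0 powr \<rho>" using True \<rho> by (intro powr_mono2) auto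
      also have "\<dots> = X" by (simp add: A_def e_def X_def powr_powr)
      also have "z \<in> {-\<bar>t\<bar>..1 + \<bar>t\<bar>}"
      proof -
        have "\<bar>t * y\<bar> \<le> \<bar>t\<bar> * 1"
          unfolding abs_mult using xy by (intro mult_left_mono) (auto simp: unit_square_def)
        then show ?thesis using xy z by (auto simp: unit_square_def)
      qed
      then have "X = X * indicat_real {-\<bar>t\<bar>..1 + \<bar>t\<bar>} z" by simp
      also have "\<dots> \<le> H z" unfolding H_def using S0 by simp
      finally show ?thesis .
    next
      case False
      \<comment> \<open>The highest level with index below J not exceeding |G|; for i = J - 1 the
        next level is N, the trivial bound.\<close>
      define i where "i = Max {j. j < J \<and> A j \<le> ?G}"
      have fin: "finite {j. j < J \<and> A j \<le> ?G}" by simp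
      have "i \<in> {j. j < J \<and> A j \<le> ?G}"
        unfolding i_def using False J by (intro Max_in fin) auto
      then have i: "i < J" "A i \<le> ?G" by auto
      have "?G \<le> A (Suc i)"
      proof (cases "Suc i < J")
        case True
        have "Suc i \<notin> {j. j < J \<and> A j \<le> ?G}"
          using Max_ge[OF fin, of "Suc i"] unfolding i_def[symmetric] by auto
        then show ?thesis using True by simp
      next
        case False
        then have "Suc i = J" using i by simp
        then show ?thesis using norm_gauss_sum_le[of x y N] eJ N by (simp add: A_def)
      qed
      then have "?G powr \<rho> \<le> A (Suc i) powr \<rho> * 1" using \<rho> by (simp add: powr_mono2)
      also have "\<dots> \<le> A (Suc i) powr \<rho> * g i z"
        using g(3)[OF xy i(2)] z by (intro mult_left_mono) auto
      also have "\<dots> \<le> (\<Sum>j<J. A (Suc j) powr \<rho> * g j z)"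
        using i g(2) by (intro member_le_sum[where f = "\<lambda>j. A (Suc j) powr \<rho> * g j z"]) auto
      also have "\<dots> \<le> H z" unfolding H_def using X0 by simp
      finally show ?thesis .
    qed
  qed
  have "(LINT z|lborel. fibre_sup t \<rho> N z) \<le> (LINT z|lborel. H z)"
    using le by (intro integral_mono integrable_fibre_sup \<rho> intH)
  also have "\<dots> = X * (1 + 2 * \<bar>t\<bar>) + (\<Sum>j<J. A (Suc j) powr \<rho> * (LINT z|lborel. g j z))"
    unfolding H_def using g(1)
    by (subst Bochner_Integration.integral_add) (auto simp: Bochner_Integration.integral_sum)
  also have "\<dots> \<le> X * (1 + 2 * \<bar>t\<bar>) + (\<Sum>j<J. C * L * K * (X + Y))"
  proof (intro add_left_mono sum_mono)
    fix j assume "j \<in> {..<J}"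
    then have ej: "5 / 6 \<le> e j" "e j \<le> 1" using emono[of 0 j] emono[of j J] eJ by (auto simp: e_def)
    have A6: "A j ^ 6 = real N powr (6 * e j)"
      using N by (simp add: A_def powr_numeral[symmetric] powr_powr mult.commute)
    have N5: "real N ^ 5 = real N powr 5" using N by (simp add: powr_numeral)
    have AS: "A (Suc j) powr \<rho> = K * real N powr (\<rho> * e j)"
      by (simp add: A_def K_def powr_powr e_def powr_add[symmetric] algebra_simps)
    have "A (Suc j) powr \<rho> * (LINT z|lborel. g j z) \<le> A (Suc j) powr \<rho> * (C * L * real N ^ 5 / A j ^ 6)"
      using g(4) by (intro mult_left_mono) auto
    also have "\<dots> = C * L * K * (real N powr (\<rho> * e j) * real N powr 5 / real N powr (6 * e j))"
      unfolding AS A6 N5 by simp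
    also have "\<dots> = C * L * K * real N powr (\<rho> * e j + 5 - 6 * e j)"
      by (simp add: powr_add powr_diff)
    \<comment> \<open>The exponent is linear in \<open>e j\<close> with slope \<rho> - 6, so its
      maximum on [5/6, 1] is at an end: 5 \<rho> / 6 or \<rho> - 1.\<close>
    also have "real N powr (\<rho> * e j + 5 - 6 * e j) \<le> X + Y"
    proof (cases "\<rho> \<ge> 6")
      case True
      have "(\<rho> - 6) * e j \<le> (\<rho> - 6) * 1" using True ej by (intro mult_left_mono) auto
      then have "real N powr (\<rho> * e j + 5 - 6 * e j) \<le> Y"
        unfolding Y_def using N1 by (intro powr_mono) (auto simp: algebra_simps)
      then show ?thesis by (simp add: X_def add_increasing)
    next
      case False
      have "(6 - \<rho>) * (5 / 6) \<le> (6 - \<rho>) * e j" using False ej by (intro mult_left_mono) auto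
      then have "\<rho> * e j + 5 - 6 * e j \<le> 5 * \<rho> / 6" unfolding left_diff_distrib by linarith
      then have "real N powr (\<rho> * e j + 5 - 6 * e j) \<le> X"
        unfolding X_def using N1 by (intro powr_mono) auto
      then show ?thesis by (simp add: Y_def add_increasing2)
    qed
    finally show "A (Suc j) powr \<rho> * (LINT z|lborel. g j z) \<le> C * L * K * (X + Y)"
      using L K1 by (simp add: C_def mult_left_mono)
  qed
  also have "X * (1 + 2 * \<bar>t\<bar>) \<le> (1 + 2 * \<bar>t\<bar>) * (L * K * (X + Y))"
  proof -
    have "1 * 1 \<le> L * K" using L K1 by (intro mult_mono) auto
    then have "1 * X \<le> L * K * (X + Y)" by (intro mult_mono) (auto simp: X_def Y_def)
    then have "(1 + 2 * \<bar>t\<bar>) * X \<le> (1 + 2 * \<bar>t\<bar>) * (L * K * (X + Y))"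
      by (intro mult_left_mono) auto
    then show ?thesis by (simp add: mult.commute)
  qed
  also have "(1 + 2 * \<bar>t\<bar>) * (L * K * (X + Y)) + (\<Sum>j<J. C * L * K * (X + Y))
      = (1 + 2 * \<bar>t\<bar> + real J * C) * L * K * (X + Y)"
    by (simp add: algebra_simps)
  finally show ?thesis
    by (simp add: C_def L_def K_def X_def Y_def \<kappa>_def)
qed

theorem theorem1p5:
  fixes t \<rho> :: real
  assumes "\<rho> > 0"
  shows "\<forall>\<epsilon>>0. \<forall>\<^sub>F N in sequentially.
           proj_norm t \<rho> N \<le> real N powr (5 / 6 + \<epsilon>) + real N powr (1 - 1 / \<rho> + \<epsilon>)"
proof (intro allI impI)
  fix \<epsilon> :: real assume \<epsilon>: "\<epsilon> > 0"
  \<comment> \<open>Enough levels for their spacing to cost at most half of \<epsilon>.\<close>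
  obtain J :: nat where J: "J > 0" "1 / (6 * real J) \<le> \<epsilon> / 2"
  proof -
    obtain n :: nat where n: "real n > 1 / (3 * \<epsilon>)" using reals_Archimedean2 by blast
    then have "n > 0" using \<epsilon> by (metis divide_nonneg_pos gr0I less_le_not_le mult_pos_pos of_nat_0 zero_less_numeral zero_le_one)
    then show thesis using n \<epsilon> by (intro that[of n]) (auto simp: field_simps)
  qed
  define C where "C = 1 + 2 * \<bar>t\<bar> + real J * (784 * (24 + 2 * \<bar>t\<bar>))"
  have C: "C > 0" by (simp add: C_def add_pos_nonneg)
  \<comment> \<open>One factor N^d absorbs the constant and the logarithm, another the level
    spacing; N^(2 d) becomes N^\<epsilon> after the \<rho>-th root.\<close>
  define d where "d = \<epsilon> * \<rho> / 2"
  have d: "d > 0" using \<epsilon> assms by (simp add: d_def)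
  have "\<forall>\<^sub>F N in sequentially. 50 * real N * (1 + ln (real N)) \<le> real N powr (5 / 3)"
    by real_asymp
  moreover have "\<forall>\<^sub>F N in sequentially. 2 * C * (1 + ln (real N)) \<le> real N powr d"
    using C d by real_asymp
  ultimately show "\<forall>\<^sub>F N in sequentially.
      proj_norm t \<rho> N \<le> real N powr (5 / 6 + \<epsilon>) + real N powr (1 - 1 / \<rho> + \<epsilon>)"
    using eventually_gt_at_top[of 0]
  proof eventually_elim
    case (elim N)
    define X where "X = real N powr (5 * \<rho> / 6)"
    define Y where "Y = real N powr (\<rho> - 1)"
    \<comment> \<open>With the maximum, Z^\<rho> bounds both terms and hence their mean, for \<rho>
      below or above 1 alike; the mean comes from the 2 in \<open>2 * C\<close>.\<close>
    define Z where "Z = max (real N powr (5 / 6 + \<epsilon>)) (real N powr (1 - 1 / \<rho> + \<epsilon>))"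
    have N1: "real N \<ge> 1" using elim by simp
    have Z0: "Z \<ge> 0" by (simp add: Z_def le_max_iff_disj)
    have "\<rho> * (1 / (6 * real J)) \<le> \<rho> * (\<epsilon> / 2)"
      using J assms by (intro mult_left_mono) auto
    then have K: "real N powr (\<rho> / (6 * real J)) \<le> real N powr d"
      using N1 by (intro powr_mono) (auto simp: d_def mult.commute)
    have XZ: "real N powr d * real N powr d * X \<le> Z powr \<rho>"
    proof -
      have "real N powr d * real N powr d * X = (real N powr (5 / 6 + \<epsilon>)) powr \<rho>"
        by (simp add: X_def d_def powr_powr powr_add[symmetric] algebra_simps)
      also have "\<dots> \<le> Z powr \<rho>" using assms by (intro powr_mono2) (auto simp: Z_def)
      finally show ?thesis .
    qed
    have YZ: "real N powr d * real N powr d * Y \<le> Z powr \<rho>"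
    proof -
      have "real N powr d * real N powr d * Y = (real N powr (1 - 1 / \<rho> + \<epsilon>)) powr \<rho>"
        using assms by (simp add: Y_def d_def powr_powr powr_add[symmetric] algebra_simps)
      also have "\<dots> \<le> Z powr \<rho>" using assms by (intro powr_mono2) (auto simp: Z_def)
      finally show ?thesis .
    qed
    have "(LINT z|lborel. fibre_sup t \<rho> N z) \<le> C * (1 + ln (real N)) * real N powr (\<rho> / (6 * real J)) * (X + Y)"
      unfolding C_def X_def Y_def using elim J by (intro integral_fibre_sup_le assms) auto
    also have "\<dots> \<le> (real N powr d / 2) * real N powr d * (X + Y)"
      using elim C K by (intro mult_mono) (auto simp: X_def Y_def)
    also have "\<dots> = (real N powr d * real N powr d * X + real N powr d * real N powr d * Y) / 2"
      by (simp add: algebra_simps)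
    also have "\<dots> \<le> Z powr \<rho>" using XZ YZ by simp
    finally have "(LINT z|lborel. fibre_sup t \<rho> N z) powr (1 / \<rho>) \<le> (Z powr \<rho>) powr (1 / \<rho>)"
      using assms by (intro powr_mono2 Bochner_Integration.integral_nonneg fibre_sup_nonneg) auto
    also have "\<dots> = Z" using assms Z0 by (simp add: powr_powr)
    also have "Z \<le> real N powr (5 / 6 + \<epsilon>) + real N powr (1 - 1 / \<rho> + \<epsilon>)"
      by (simp add: Z_def)
    finally show ?case by (simp add: proj_norm_def)
  qed
qed

end
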